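(* (Workload of unzipping.) For every $S\in\lambda LL^{\mathtt A}$, $\mathcal W(\mathcal U(S))\le\mathcal W(S)$. If moreover $S$ is safe, then $\mathcal U(S)$ is safe too.
   Context: **Calculus $\lambda LL$.** Fix function symbols $\underline f$ with arities $n\ge 1$, each denoting a differentiable $f:\mathbb R^n\to\mathbb R$. Types: $A,B::=\mathbb R\mid A\multimap B\mid 1\mid A\otimes B\mid\top\mid A\& B\mid {!A}$. Each variable has a fixed type. Patterns: $p,q::=x\mid {!x}\mid ()\mid (p,q)\mid\langle p,q\rangle$, no variable repeated, typed by $x:A$, $!x:{!A}$ (for $x$ of type $A$), $():1$, $(p,q):A\otimes B$, $\langle p,q\rangle:A\& B$. An environment is a finite set of typed patterns with disjoint variables; $!\Gamma$ means all patterns are of the form $!x$; the comma is variable-disjoint union. Terms: $M,N::=x\mid {!M}\mid\lambda p.M\mid MN\mid ()\mid (M,N)\mid\langle\rangle\mid\langle M,N\rangle\mid\underline r\mid\underline f\mid\dot+\mid\dot*$ ($r\in\mathbb R$). Typing: $x:A\vdash x:A$; $!x:{!A}\vdash x:A$; $!\Gamma\vdash M:A\Rightarrow{!\Gamma}\vdash{!M}:{!A}$; $\Delta\vdash M:B\Rightarrow{!x}:{!A},\Delta\vdash M:B$; $p:A,\Delta\vdash M:B\Rightarrow\Delta\vdash\lambda p.M:A\multimap B$; if $!\Gamma_i,\Delta_i\vdash M_i:A_i$ ($i=1,2$) then $!\Gamma_1\cup{!\Gamma_2},\Delta_1,\Delta_2\vdash M_1M_2:B$ when $A_1=A_2\multimap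 B$, and $\vdash(M_1,M_2):A_1\otimes A_2$ in that same environment; $\vdash():1$; $\Delta\vdash M:B\Rightarrow():1,\Delta\vdash M:B$; $p:A,q:B,\Delta\vdash M:C\Rightarrow(p,q):A\otimes B,\Delta\vdash M:C$; $\Delta\vdash M_1:A_1$ and $\Delta\vdash M_2:A_2\Rightarrow\Delta\vdash\langle M_1,M_2\rangle:A_1\& A_2$; $p_i:A_i,\Delta\vdash M:B\Rightarrow\langle p_1,p_2\rangle:A_1\& A_2,\Delta\vdash M:B$ ($i=1$ or $2$); $\Delta\vdash\langle\rangle:\top$; $\vdash\underline r:\mathbb R$; $\Delta\vdash\underline0:\mathbb R$; $\vdash\underline f:({!\mathbb R}\otimes\dots\otimes{!\mathbb R})\multimap{!\mathbb R}$; $\vdash\dot+:\mathbb R\&\mathbb R\multimap\mathbb R$; $\vdash\dot*:\mathbb R\multimap\mathbb R\multimap\mathbb R$. **Workload.** $\mathcal W(A)$ is the number of occurrences of $\mathbb R$ in the type $A$ not under a $!$. On terms: $\mathcal W(\underline f)=\mathcal W(\dot+)=\mathcal W(\dot* )=1$; $\mathcal W(x)=\mathcal W(!M)=\mathcal W(())=\mathcal W(\langle\rangle)=\mathcal W(\underline r)=0$; $\mathcal W(\lambda p.M)=\mathcal W(M)+\sum_{x:A\,\in\,FV(p)\setminus FV(M)}\mathcal W(A)$; $\mathcal W(MN)=\mathcal W((M,N))=\mathcal W(\langle M,N\rangle)=\mathcal W(M)+\mathcal W(N)$. **Safe term.** A variable is ground if its type contains no $\multimap$. A term $M$ is safe if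 (i) for every subterm $!M'$ of $M$, $\mathcal W(M')=0$; (ii) for every subterm $\langle M_1,M_2\rangle$ of $M$, $FV(M_1)\cap FV(M_2)$ contains only ground variables. **Abbreviations.** $\mathtt{let}\ p=N\ \mathtt{in}\ M:=(\lambda p.M)N$; $\S A:=1\& A$ and $\S M:=\langle(),M\rangle$ for terms and patterns $M$. **Fragments.** Types $D,E::=\mathbb R\mid1\mid{!D}\otimes{!E}$ and $L,H::=\mathbb R\mid\top\mid L\& H$. Variables $x,z$ have types of the form $E$, variables $u$ types of the form $L$, variables $f$ types of the form $L\multimap H$; $p^{\&}$ ranges over patterns of a type $L$ built from variables $u$ and $\langle\cdot,\cdot\rangle$; $p^\otimes$ over the patterns $()$ and $(!x_1,!x_2)$. - $\lambda LL^{\mathtt p}$: $P,Q::={!x}\mid{!\underline r}\mid{!()}\mid\underline f(!x_1,\dots,!x_n)\mid\mathtt{let}\,{!x}=Q\,\mathtt{in}\,P\mid\mathtt{let}\,p^\otimes=z\,\mathtt{in}\,P$ - $\lambda LL^{\mathtt t}$: $U::=u\mid\underline0\mid\langle\rangle\mid\langle U_1,U_2\rangle\mid FU$ - $\lambda LL^{\mathtt f}$: $F,G::=f\mid\dot+\mid\dot*x\mid\lambda p^{\&}.U\mid\mathtt{let}\,\S f=\S F\,\mathtt{in}\,G$ - $\lambda LL^{\mathtt A}$: $R,S::=(P,\S F)\mid\mathtt{let}\,(!x,\S f)=S\,\mathtt{in}\,R\mid\mathtt{let}\,\S f=\S F\,\mathtt{in}\,R\mid\mathtt{let}\,{!x}=P\,\mathtt{in}\,R\mid\mathtt{let}\,p^\otimes=z\,\mathtt{in}\,R$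 Terms are well-typed as: $!\Sigma\vdash P:{!E}$; $!\Sigma,\S\Phi,p^{\&}:L\vdash U:H$; $!\Sigma,\S\Phi\vdash F:L\multimap H$; $!\Sigma,\S\Phi\vdash R:{!E}\otimes\S(L\multimap H)$, where $!\Sigma$ consists of patterns $!x:{!E}$ and $\S\Phi$ of patterns $\S f:\S(L\multimap H)$. **Unzipping $\mathcal U$.** A decomposition $\mathcal U^\bullet(S)=(\epsilon[\,],P,F)$, with $\epsilon[\,]$ a one-hole context, $P\in\lambda LL^{\mathtt p}$, $F\in\lambda LL^{\mathtt f}$, is defined inductively (bound variables being renamed to avoid unintended capture), writing $\mathcal U^\bullet(S_i)=(\epsilon_i[\,],P_i,F_i)$: - $\mathcal U^\bullet((P,\S F))=([\,],P,F)$; - $\mathcal U^\bullet(\mathtt{let}\,(!x,\S f)=S_1\,\mathtt{in}\,S_2)=(\epsilon_1[\mathtt{let}\,{!x}=P_1\,\mathtt{in}\,\epsilon_2[\,]],\,P_2,\,\mathtt{let}\,\S f=\S F_1\,\mathtt{in}\,F_2)$; - $\mathcal U^\bullet(\mathtt{let}\,{!x}=P\,\mathtt{in}\,S_1)=(\mathtt{let}\,{!x}=P\,\mathtt{in}\,\epsilon_1[\,],P_1,F_1)$; $\mathcal U^\bullet(\mathtt{let}\,p^\otimes=z\,\mathtt{in}\,S_1)=(\mathtt{let}\,p^\otimes=z\,\mathtt{in}\,\epsilon_1[\,],P_1,F_1)$; - $\mathcal U^\bullet(\mathtt{let}\,\S f=\S F\,\mathtt{in}\,S_1)=(\epsilon_1[\,],P_1,\mathtt{let}\,\S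 f=\S F\,\mathtt{in}\,F_1)$. Then $\mathcal U(S):=\epsilon[(P,\S F)]$. *)

theory Defs
  imports "HOL-Analysis.L2_Norm"
begin

section \<open>Types, variables, patterns, terms\<close>

datatype ty =
    TReal
  | Lolli ty ty
  | TOne
  | TTens ty ty
  | TTop
  | TWith ty ty
  | TBang ty

datatype var = V (vname: nat) (vty: ty)

datatype pat =
    PVar var
  | PBang var
  | PUnit
  | PTens pat pat
  | PWith pat pat

primrec pvars :: "pat \<Rightarrow> var set" where
  "pvars (PVar x) = {x}"
| "pvars (PBang x) = {x}"
| "pvars PUnit = {}"
| "pvars (PTens p q) = pvars p \<union> pvars q"
| "pvars (PWith p q) = pvars p \<union> pvars q"

text \<open>As every variable has a fixed type, a pattern \<open>p\<close> has exactly one type \<open>pty p\<close>, and a typed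
  pattern is just a pattern without repeated variables.\<close>

primrec pty :: "pat \<Rightarrow> ty" where
  "pty (PVar x) = vty x"
| "pty (PBang x) = TBang (vty x)"
| "pty PUnit = TOne"
| "pty (PTens p q) = TTens (pty p) (pty q)"
| "pty (PWith p q) = TWith (pty p) (pty q)"

primrec linear_pat :: "pat \<Rightarrow> bool" where
  "linear_pat (PVar x) = True"
| "linear_pat (PBang x) = True"
| "linear_pat PUnit = True"
| "linear_pat (PTens p q) = (linear_pat p \<and> linear_pat q \<and> pvars p \<inter> pvars q = {})"
| "linear_pat (PWith p q) = (linear_pat p \<and> linear_pat q \<and> pvars p \<inter> pvars q = {})"

text \<open>\<open>'f\<close> is the type of function symbols. \<open>Tens M N\<close> is $(M,N)$, \<open>Pair M N\<close> is
  $\langle M,N\rangle$, and \<open>Unit\<close>, \<open>Top\<close> are their nullary versions.\<close>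

datatype 'f tm =
    Var var
  | Bang "'f tm"
  | Lam pat "'f tm"
  | App "'f tm" "'f tm"
  | Unit
  | Tens "'f tm" "'f tm"
  | Top
  | Pair "'f tm" "'f tm"
  | Const real
  | Fun 'f
  | Plus
  | Times

abbreviation LetIn :: "pat \<Rightarrow> 'f tm \<Rightarrow> 'f tm \<Rightarrow> 'f tm"
  (\<open>(\<open>notation=\<open>mixfix LetIn\<close>\<close>LET _ \<leftarrow> _ IN _)\<close> [0, 0, 10] 10) where
  "LET p \<leftarrow> N IN M \<equiv> App (Lam p M) N"

text \<open>The three uses of the sign $\S$: on types, patterns and terms.\<close>

abbreviation sec_ty :: "ty \<Rightarrow> ty" where "sec_ty A \<equiv> TWith TOne A"
abbreviation sec_pat :: "pat \<Rightarrow> pat" where "sec_pat p \<equiv> PWith PUnit p"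
abbreviation sec_tm :: "'f tm \<Rightarrow> 'f tm" where "sec_tm M \<equiv> Pair Unit M"

text \<open>Tensors with more than two factors are nested to the right; a unary tensor is its factor.\<close>

fun tens_ty :: "ty list \<Rightarrow> ty" where
  "tens_ty [] = TOne"
| "tens_ty [A] = A"
| "tens_ty (A # B # As) = TTens A (tens_ty (B # As))"

fun tens_tm :: "'f tm list \<Rightarrow> 'f tm" where
  "tens_tm [] = Unit"
| "tens_tm [M] = M"
| "tens_tm (M # N # Ms) = Tens M (tens_tm (N # Ms))"

primrec FV :: "'f tm \<Rightarrow> var set" where
  "FV (Var x) = {x}"
| "FV (Bang M) = FV M"
| "FV (Lam p M) = FV M - pvars p"
| "FV (App M N) = FV M \<union> FV N"
| "FV Unit = {}"
| "FV (Tens M N) = FV M \<union> FV N"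
| "FV Top = {}"
| "FV (Pair M N) = FV M \<union> FV N"
| "FV (Const r) = {}"
| "FV (Fun f) = {}"
| "FV Plus = {}"
| "FV Times = {}"

text \<open>A function of the first \<open>n\<close> coordinates is rendered on sequences; the remainder estimate
  (with \<open>L2_set\<close> the Euclidean norm on $\mathbb R^n$) is Frechet differentiability at every point,
  and it also forces \<open>g\<close> to ignore the coordinates from \<open>n\<close> on.\<close>

definition differentiable_n :: "nat \<Rightarrow> ((nat \<Rightarrow> real) \<Rightarrow> real) \<Rightarrow> bool" where
  "differentiable_n n g \<longleftrightarrow>
     (\<forall>x. \<exists>a :: nat \<Rightarrow> real. \<forall>e>0. \<exists>d>0. \<forall>y.
        L2_set (\<lambda>i. y i - x i) {..<n} < d \<longrightarrow>
        \<bar>g y - g x - (\<Sum>i<n. a i * (y i - x i))\<bar> \<le> e * L2_set (\<lambda>i. y i - x i) {..<n})"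

definition signature :: "('f \<Rightarrow> nat) \<Rightarrow> ('f \<Rightarrow> (nat \<Rightarrow> real) \<Rightarrow> real) \<Rightarrow> bool" where
  "signature ar den \<longleftrightarrow> (\<forall>f. 1 \<le> ar f \<and> differentiable_n (ar f) (den f))"


section \<open>Typing\<close>

definition vars :: "pat set \<Rightarrow> var set" where
  "vars \<Gamma> = (\<Union>p\<in>\<Gamma>. pvars p)"

definition environment :: "pat set \<Rightarrow> bool" where
  "environment \<Gamma> \<longleftrightarrow> finite \<Gamma> \<and> (\<forall>p\<in>\<Gamma>. linear_pat p) \<and>
     (\<forall>p\<in>\<Gamma>. \<forall>q\<in>\<Gamma>. p \<noteq> q \<longrightarrow> pvars p \<inter> pvars q = {})"

definition bang_env :: "pat set \<Rightarrow> bool" where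
  "bang_env \<Gamma> \<longleftrightarrow> \<Gamma> \<subseteq> range PBang"

text \<open>The comma is \<open>\<union>\<close> or \<open>insert\<close> together with explicit disjointness of variables. In the binary
  rules the banged parts \<open>\<Gamma>\<^sub>1\<close>, \<open>\<Gamma>\<^sub>2\<close> may overlap.\<close>

definition split_env :: "pat set \<Rightarrow> pat set \<Rightarrow> pat set \<Rightarrow> pat set \<Rightarrow> bool" where
  "split_env \<Gamma>\<^sub>1 \<Gamma>\<^sub>2 \<Delta>\<^sub>1 \<Delta>\<^sub>2 \<longleftrightarrow> bang_env \<Gamma>\<^sub>1 \<and> bang_env \<Gamma>\<^sub>2 \<and>
     vars (\<Gamma>\<^sub>1 \<union> \<Gamma>\<^sub>2) \<inter> vars \<Delta>\<^sub>1 = {} \<and> vars (\<Gamma>\<^sub>1 \<union> \<Gamma>\<^sub>2) \<inter> vars \<Delta>\<^sub>2 = {} \<and> vars \<Delta>\<^sub>1 \<inter> vars \<Delta>\<^sub>2 = {}"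

inductive typing :: "('f \<Rightarrow> nat) \<Rightarrow> pat set \<Rightarrow> 'f tm \<Rightarrow> ty \<Rightarrow> bool" for ar where
  t_var: "typing ar {PVar x} (Var x) (vty x)"
| t_bvar: "typing ar {PBang x} (Var x) (vty x)"
| t_bang: "bang_env \<Gamma> \<Longrightarrow> typing ar \<Gamma> M A \<Longrightarrow> typing ar \<Gamma> (Bang M) (TBang A)"
| t_weak: "typing ar \<Delta> M B \<Longrightarrow> x \<notin> vars \<Delta> \<Longrightarrow> typing ar (insert (PBang x) \<Delta>) M B"
| t_lam: "linear_pat p \<Longrightarrow> pvars p \<inter> vars \<Delta> = {} \<Longrightarrow> typing ar (insert p \<Delta>) M B \<Longrightarrow>
    typing ar \<Delta> (Lam p M) (Lolli (pty p) B)"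
| t_app: "split_env \<Gamma>\<^sub>1 \<Gamma>\<^sub>2 \<Delta>\<^sub>1 \<Delta>\<^sub>2 \<Longrightarrow> typing ar (\<Gamma>\<^sub>1 \<union> \<Delta>\<^sub>1) M\<^sub>1 (Lolli A B) \<Longrightarrow> typing ar (\<Gamma>\<^sub>2 \<union> \<Delta>\<^sub>2) M\<^sub>2 A \<Longrightarrow>
    typing ar (\<Gamma>\<^sub>1 \<union> \<Gamma>\<^sub>2 \<union> \<Delta>\<^sub>1 \<union> \<Delta>\<^sub>2) (App M\<^sub>1 M\<^sub>2) B"
| t_tens: "split_env \<Gamma>\<^sub>1 \<Gamma>\<^sub>2 \<Delta>\<^sub>1 \<Delta>\<^sub>2 \<Longrightarrow> typing ar (\<Gamma>\<^sub>1 \<union> \<Delta>\<^sub>1) M\<^sub>1 A\<^sub>1 \<Longrightarrow> typing ar (\<Gamma>\<^sub>2 \<union> \<Delta>\<^sub>2) M\<^sub>2 A\<^sub>2 \<Longrightarrow>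
    typing ar (\<Gamma>\<^sub>1 \<union> \<Gamma>\<^sub>2 \<union> \<Delta>\<^sub>1 \<union> \<Delta>\<^sub>2) (Tens M\<^sub>1 M\<^sub>2) (TTens A\<^sub>1 A\<^sub>2)"
| t_unit: "typing ar {} Unit TOne"
| t_unit_left: "typing ar \<Delta> M B \<Longrightarrow> typing ar (insert PUnit \<Delta>) M B"
| t_tens_left: "linear_pat (PTens p q) \<Longrightarrow> pvars (PTens p q) \<inter> vars \<Delta> = {} \<Longrightarrow>
    typing ar (insert p (insert q \<Delta>)) M C \<Longrightarrow> typing ar (insert (PTens p q) \<Delta>) M C"
| t_pair: "typing ar \<Delta> M\<^sub>1 A\<^sub>1 \<Longrightarrow> typing ar \<Delta> M\<^sub>2 A\<^sub>2 \<Longrightarrow> typing ar \<Delta> (Pair M\<^sub>1 M\<^sub>2) (TWith A\<^sub>1 A\<^sub>2)"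
| t_with_left1: "linear_pat (PWith p\<^sub>1 p\<^sub>2) \<Longrightarrow> pvars (PWith p\<^sub>1 p\<^sub>2) \<inter> vars \<Delta> = {} \<Longrightarrow>
    typing ar (insert p\<^sub>1 \<Delta>) M B \<Longrightarrow> typing ar (insert (PWith p\<^sub>1 p\<^sub>2) \<Delta>) M B"
| t_with_left2: "linear_pat (PWith p\<^sub>1 p\<^sub>2) \<Longrightarrow> pvars (PWith p\<^sub>1 p\<^sub>2) \<inter> vars \<Delta> = {} \<Longrightarrow>
    typing ar (insert p\<^sub>2 \<Delta>) M B \<Longrightarrow> typing ar (insert (PWith p\<^sub>1 p\<^sub>2) \<Delta>) M B"
| t_top: "environment \<Delta> \<Longrightarrow> typing ar \<Delta> Top TTop"
| t_const: "typing ar {} (Const r) TReal"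
| t_zero: "environment \<Delta> \<Longrightarrow> typing ar \<Delta> (Const 0) TReal"
| t_fun: "typing ar {} (Fun f) (Lolli (tens_ty (replicate (ar f) (TBang TReal))) (TBang TReal))"
| t_plus: "typing ar {} Plus (Lolli (TWith TReal TReal) TReal)"
| t_times: "typing ar {} Times (Lolli TReal (Lolli TReal TReal))"


section \<open>Workload and safety\<close>

primrec workload_ty :: "ty \<Rightarrow> nat" where
  "workload_ty TReal = 1"
| "workload_ty (Lolli A B) = workload_ty A + workload_ty B"
| "workload_ty TOne = 0"
| "workload_ty (TTens A B) = workload_ty A + workload_ty B"
| "workload_ty TTop = 0"
| "workload_ty (TWith A B) = workload_ty A + workload_ty B"
| "workload_ty (TBang A) = 0"

primrec workload :: "'f tm \<Rightarrow> nat" where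
  "workload (Var x) = 0"
| "workload (Bang M) = 0"
| "workload (Lam p M) = workload M + (\<Sum>x \<in> pvars p - FV M. workload_ty (vty x))"
| "workload (App M N) = workload M + workload N"
| "workload Unit = 0"
| "workload (Tens M N) = workload M + workload N"
| "workload Top = 0"
| "workload (Pair M N) = workload M + workload N"
| "workload (Const r) = 0"
| "workload (Fun f) = 1"
| "workload Plus = 1"
| "workload Times = 1"

primrec subterms :: "'f tm \<Rightarrow> 'f tm set" where
  "subterms (Var x) = {Var x}"
| "subterms (Bang M) = insert (Bang M) (subterms M)"
| "subterms (Lam p M) = insert (Lam p M) (subterms M)"
| "subterms (App M N) = insert (App M N) (subterms M \<union> subterms N)"
| "subterms Unit = {Unit}"
| "subterms (Tens M N) = insert (Tens M N) (subterms M \<union> subterms N)"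
| "subterms Top = {Top}"
| "subterms (Pair M N) = insert (Pair M N) (subterms M \<union> subterms N)"
| "subterms (Const r) = {Const r}"
| "subterms (Fun f) = {Fun f}"
| "subterms Plus = {Plus}"
| "subterms Times = {Times}"

primrec ground_ty :: "ty \<Rightarrow> bool" where
  "ground_ty TReal = True"
| "ground_ty (Lolli A B) = False"
| "ground_ty TOne = True"
| "ground_ty (TTens A B) = (ground_ty A \<and> ground_ty B)"
| "ground_ty TTop = True"
| "ground_ty (TWith A B) = (ground_ty A \<and> ground_ty B)"
| "ground_ty (TBang A) = ground_ty A"

definition safe :: "'f tm \<Rightarrow> bool" where
  "safe M \<longleftrightarrow>
     (\<forall>M'. Bang M' \<in> subterms M \<longrightarrow> workload M' = 0) \<and>
     (\<forall>M\<^sub>1 M\<^sub>2. Pair M\<^sub>1 M\<^sub>2 \<in> subterms M \<longrightarrow> (\<forall>x \<in> FV M\<^sub>1 \<inter> FV M\<^sub>2. ground_ty (vty x)))"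


section \<open>Fragments\<close>

inductive E_ty :: "ty \<Rightarrow> bool" where
  "E_ty TReal"
| "E_ty TOne"
| "E_ty D \<Longrightarrow> E_ty E \<Longrightarrow> E_ty (TTens (TBang D) (TBang E))"

inductive L_ty :: "ty \<Rightarrow> bool" where
  "L_ty TReal"
| "L_ty TTop"
| "L_ty L \<Longrightarrow> L_ty H \<Longrightarrow> L_ty (TWith L H)"

definition E_var :: "var \<Rightarrow> bool" where "E_var x \<longleftrightarrow> E_ty (vty x)"
definition L_var :: "var \<Rightarrow> bool" where "L_var u \<longleftrightarrow> L_ty (vty u)"
definition LH_var :: "var \<Rightarrow> bool" where
  "LH_var f \<longleftrightarrow> (\<exists>L H. L_ty L \<and> L_ty H \<and> vty f = Lolli L H)"

inductive with_pat :: "pat \<Rightarrow> bool" where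
  "L_var u \<Longrightarrow> with_pat (PVar u)"
| "with_pat p \<Longrightarrow> with_pat q \<Longrightarrow> pvars p \<inter> pvars q = {} \<Longrightarrow> with_pat (PWith p q)"

inductive tens_pat :: "pat \<Rightarrow> bool" where
  "tens_pat PUnit"
| "E_var x\<^sub>1 \<Longrightarrow> E_var x\<^sub>2 \<Longrightarrow> x\<^sub>1 \<noteq> x\<^sub>2 \<Longrightarrow> tens_pat (PTens (PBang x\<^sub>1) (PBang x\<^sub>2))"

definition sigma_env :: "pat set \<Rightarrow> bool" where
  "sigma_env \<Sigma> \<longleftrightarrow> \<Sigma> \<subseteq> {PBang x | x. E_var x}"

definition phi_env :: "pat set \<Rightarrow> bool" where
  "phi_env \<Phi> \<longleftrightarrow> \<Phi> \<subseteq> {sec_pat (PVar f) | f. LH_var f}"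

definition wt_p :: "('f \<Rightarrow> nat) \<Rightarrow> 'f tm \<Rightarrow> bool" where
  "wt_p ar P \<longleftrightarrow> (\<exists>\<Sigma> E. sigma_env \<Sigma> \<and> E_ty E \<and> environment \<Sigma> \<and> typing ar \<Sigma> P (TBang E))"

definition wt_t :: "('f \<Rightarrow> nat) \<Rightarrow> 'f tm \<Rightarrow> bool" where
  "wt_t ar U \<longleftrightarrow> (\<exists>\<Sigma> \<Phi> p H. sigma_env \<Sigma> \<and> phi_env \<Phi> \<and> with_pat p \<and> L_ty H \<and>
     environment (\<Sigma> \<union> \<Phi> \<union> {p}) \<and> typing ar (\<Sigma> \<union> \<Phi> \<union> {p}) U H)"

definition wt_f :: "('f \<Rightarrow> nat) \<Rightarrow> 'f tm \<Rightarrow> bool" where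
  "wt_f ar F \<longleftrightarrow> (\<exists>\<Sigma> \<Phi> L H. sigma_env \<Sigma> \<and> phi_env \<Phi> \<and> L_ty L \<and> L_ty H \<and>
     environment (\<Sigma> \<union> \<Phi>) \<and> typing ar (\<Sigma> \<union> \<Phi>) F (Lolli L H))"

definition wt_A :: "('f \<Rightarrow> nat) \<Rightarrow> 'f tm \<Rightarrow> bool" where
  "wt_A ar R \<longleftrightarrow> (\<exists>\<Sigma> \<Phi> E L H. sigma_env \<Sigma> \<and> phi_env \<Phi> \<and> E_ty E \<and> L_ty L \<and> L_ty H \<and>
     environment (\<Sigma> \<union> \<Phi>) \<and> typing ar (\<Sigma> \<union> \<Phi>) R (TTens (TBang E) (sec_ty (Lolli L H))))"

text \<open>Well-typedness is imposed on every term of every fragment, not only at the root: the general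
  typing rules would for instance accept a subterm \<open>F\<close> using the variables of an enclosing \<open>p\<close>.\<close>

inductive frag_p :: "('f \<Rightarrow> nat) \<Rightarrow> 'f tm \<Rightarrow> bool" for ar where
  p_var: "E_var x \<Longrightarrow> wt_p ar (Bang (Var x)) \<Longrightarrow> frag_p ar (Bang (Var x))"
| p_const: "wt_p ar (Bang (Const r)) \<Longrightarrow> frag_p ar (Bang (Const r))"
| p_unit: "wt_p ar (Bang Unit) \<Longrightarrow> frag_p ar (Bang Unit)"
| p_fun: "length xs = ar g \<Longrightarrow> (\<forall>x \<in> set xs. E_var x) \<Longrightarrow>
    wt_p ar (App (Fun g) (tens_tm (map (\<lambda>x. Bang (Var x)) xs))) \<Longrightarrow>
    frag_p ar (App (Fun g) (tens_tm (map (\<lambda>x. Bang (Var x)) xs)))"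
| p_let: "E_var x \<Longrightarrow> frag_p ar Q \<Longrightarrow> frag_p ar P \<Longrightarrow> wt_p ar (LET PBang x \<leftarrow> Q IN P) \<Longrightarrow>
    frag_p ar (LET PBang x \<leftarrow> Q IN P)"
| p_let_tens: "tens_pat p \<Longrightarrow> E_var z \<Longrightarrow> frag_p ar P \<Longrightarrow> wt_p ar (LET p \<leftarrow> Var z IN P) \<Longrightarrow>
    frag_p ar (LET p \<leftarrow> Var z IN P)"

inductive frag_t :: "('f \<Rightarrow> nat) \<Rightarrow> 'f tm \<Rightarrow> bool"
  and frag_f :: "('f \<Rightarrow> nat) \<Rightarrow> 'f tm \<Rightarrow> bool" for ar where
  t_var: "L_var u \<Longrightarrow> wt_t ar (Var u) \<Longrightarrow> frag_t ar (Var u)"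
| t_zero: "wt_t ar (Const 0) \<Longrightarrow> frag_t ar (Const 0)"
| t_top: "wt_t ar Top \<Longrightarrow> frag_t ar Top"
| t_pair: "frag_t ar U\<^sub>1 \<Longrightarrow> frag_t ar U\<^sub>2 \<Longrightarrow> wt_t ar (Pair U\<^sub>1 U\<^sub>2) \<Longrightarrow> frag_t ar (Pair U\<^sub>1 U\<^sub>2)"
| t_app: "frag_f ar F \<Longrightarrow> frag_t ar U \<Longrightarrow> wt_t ar (App F U) \<Longrightarrow> frag_t ar (App F U)"
| f_var: "LH_var f \<Longrightarrow> wt_f ar (Var f) \<Longrightarrow> frag_f ar (Var f)"
| f_plus: "wt_f ar Plus \<Longrightarrow> frag_f ar Plus"
| f_times: "E_var x \<Longrightarrow> wt_f ar (App Times (Var x)) \<Longrightarrow> frag_f ar (App Times (Var x))"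
| f_lam: "with_pat p \<Longrightarrow> frag_t ar U \<Longrightarrow> wt_f ar (Lam p U) \<Longrightarrow> frag_f ar (Lam p U)"
| f_let: "LH_var f \<Longrightarrow> frag_f ar F \<Longrightarrow> frag_f ar G \<Longrightarrow>
    wt_f ar (LET sec_pat (PVar f) \<leftarrow> sec_tm F IN G) \<Longrightarrow>
    frag_f ar (LET sec_pat (PVar f) \<leftarrow> sec_tm F IN G)"

inductive frag_A :: "('f \<Rightarrow> nat) \<Rightarrow> 'f tm \<Rightarrow> bool" for ar where
  A_pair: "frag_p ar P \<Longrightarrow> frag_f ar F \<Longrightarrow> wt_A ar (Tens P (sec_tm F)) \<Longrightarrow>
    frag_A ar (Tens P (sec_tm F))"
| A_let_A: "E_var x \<Longrightarrow> LH_var f \<Longrightarrow> frag_A ar S \<Longrightarrow> frag_A ar R \<Longrightarrow>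
    wt_A ar (LET PTens (PBang x) (sec_pat (PVar f)) \<leftarrow> S IN R) \<Longrightarrow>
    frag_A ar (LET PTens (PBang x) (sec_pat (PVar f)) \<leftarrow> S IN R)"
| A_let_f: "LH_var f \<Longrightarrow> frag_f ar F \<Longrightarrow> frag_A ar R \<Longrightarrow>
    wt_A ar (LET sec_pat (PVar f) \<leftarrow> sec_tm F IN R) \<Longrightarrow>
    frag_A ar (LET sec_pat (PVar f) \<leftarrow> sec_tm F IN R)"
| A_let_p: "E_var x \<Longrightarrow> frag_p ar P \<Longrightarrow> frag_A ar R \<Longrightarrow> wt_A ar (LET PBang x \<leftarrow> P IN R) \<Longrightarrow>
    frag_A ar (LET PBang x \<leftarrow> P IN R)"
| A_let_tens: "tens_pat p \<Longrightarrow> E_var z \<Longrightarrow> frag_A ar R \<Longrightarrow> wt_A ar (LET p \<leftarrow> Var z IN R) \<Longrightarrow>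
    frag_A ar (LET p \<leftarrow> Var z IN R)"


section \<open>Renaming of bound variables\<close>

primrec rename_pat :: "(var \<Rightarrow> var) \<Rightarrow> pat \<Rightarrow> pat" where
  "rename_pat \<pi> (PVar x) = PVar (\<pi> x)"
| "rename_pat \<pi> (PBang x) = PBang (\<pi> x)"
| "rename_pat \<pi> PUnit = PUnit"
| "rename_pat \<pi> (PTens p q) = PTens (rename_pat \<pi> p) (rename_pat \<pi> q)"
| "rename_pat \<pi> (PWith p q) = PWith (rename_pat \<pi> p) (rename_pat \<pi> q)"

text \<open>This acts on all occurrences of variables, free, bound and binding; it is meant for
  permutations \<open>\<pi>\<close> only.\<close>

primrec rename :: "(var \<Rightarrow> var) \<Rightarrow> 'f tm \<Rightarrow> 'f tm" where
  "rename \<pi> (Var x) = Var (\<pi> x)"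
| "rename \<pi> (Bang M) = Bang (rename \<pi> M)"
| "rename \<pi> (Lam p M) = Lam (rename_pat \<pi> p) (rename \<pi> M)"
| "rename \<pi> (App M N) = App (rename \<pi> M) (rename \<pi> N)"
| "rename \<pi> Unit = Unit"
| "rename \<pi> (Tens M N) = Tens (rename \<pi> M) (rename \<pi> N)"
| "rename \<pi> Top = Top"
| "rename \<pi> (Pair M N) = Pair (rename \<pi> M) (rename \<pi> N)"
| "rename \<pi> (Const r) = Const r"
| "rename \<pi> (Fun f) = Fun f"
| "rename \<pi> Plus = Plus"
| "rename \<pi> Times = Times"

inductive alpha :: "'f tm \<Rightarrow> 'f tm \<Rightarrow> bool" where
  "alpha (Var x) (Var x)"
| "alpha M M' \<Longrightarrow> alpha (Bang M) (Bang M')"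
| "bij \<pi> \<Longrightarrow> (\<forall>x. vty (\<pi> x) = vty x) \<Longrightarrow> (\<forall>x \<in> FV (Lam p M). \<pi> x = x) \<Longrightarrow>
    alpha (rename \<pi> M) M' \<Longrightarrow> alpha (Lam p M) (Lam (rename_pat \<pi> p) M')"
| "alpha M M' \<Longrightarrow> alpha N N' \<Longrightarrow> alpha (App M N) (App M' N')"
| "alpha Unit Unit"
| "alpha M M' \<Longrightarrow> alpha N N' \<Longrightarrow> alpha (Tens M N) (Tens M' N')"
| "alpha Top Top"
| "alpha M M' \<Longrightarrow> alpha N N' \<Longrightarrow> alpha (Pair M N) (Pair M' N')"
| "alpha (Const r) (Const r)"
| "alpha (Fun f) (Fun f)"
| "alpha Plus Plus"
| "alpha Times Times"


section \<open>Unzipping\<close>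

text \<open>The one-hole contexts produced by unzipping are chains of \<open>let\<close>s ending in the hole. Plugging a
  term in the hole captures the variables in \<open>bound C\<close>.\<close>

datatype 'f ctx = Hole | LetC pat "'f tm" "'f ctx"

primrec plug :: "'f ctx \<Rightarrow> 'f tm \<Rightarrow> 'f tm" where
  "plug Hole M = M"
| "plug (LetC p N C) M = (LET p \<leftarrow> N IN plug C M)"

primrec ctx_comp :: "'f ctx \<Rightarrow> 'f ctx \<Rightarrow> 'f ctx" where
  "ctx_comp Hole D = D"
| "ctx_comp (LetC p N C) D = LetC p N (ctx_comp C D)"

primrec bound :: "'f ctx \<Rightarrow> var set" where
  "bound Hole = {}"
| "bound (LetC p N C) = pvars p \<union> bound C"

text \<open>\<open>decomp S C P F\<close> says that \<open>(C, P, F)\<close> is a decomposition of \<open>S\<close>, for some choice of the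
  names of bound variables. The disjointness premises exclude exactly the unintended captures caused
  by moving \<open>S\<^sub>2\<close> under the binders of \<open>C\<^sub>1\<close>, and \<open>F\<^sub>1\<close> (resp. \<open>F\<close>) under those of the context
  following it; rule \<open>d_alpha\<close> allows one to rename bound variables so that they hold. (For terms of
  the fragment, contexts bind only variables of a type \<open>E\<close>, so function variables \<open>f\<close> need no such
  premise.)\<close>

inductive decomp :: "'f tm \<Rightarrow> 'f ctx \<Rightarrow> 'f tm \<Rightarrow> 'f tm \<Rightarrow> bool" where
  d_pair: "decomp (Tens P (sec_tm F)) Hole P F"
| d_let_A: "decomp S\<^sub>1 C\<^sub>1 P\<^sub>1 F\<^sub>1 \<Longrightarrow> decomp S\<^sub>2 C\<^sub>2 P\<^sub>2 F\<^sub>2 \<Longrightarrow>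
    bound C\<^sub>1 \<inter> (FV S\<^sub>2 - {x, f}) = {} \<Longrightarrow> insert x (bound C\<^sub>2) \<inter> FV F\<^sub>1 = {} \<Longrightarrow>
    decomp (LET PTens (PBang x) (sec_pat (PVar f)) \<leftarrow> S\<^sub>1 IN S\<^sub>2)
      (ctx_comp C\<^sub>1 (LetC (PBang x) P\<^sub>1 C\<^sub>2)) P\<^sub>2 (LET sec_pat (PVar f) \<leftarrow> sec_tm F\<^sub>1 IN F\<^sub>2)"
| d_let_p: "decomp S\<^sub>1 C\<^sub>1 P\<^sub>1 F\<^sub>1 \<Longrightarrow>
    decomp (LET PBang x \<leftarrow> P IN S\<^sub>1) (LetC (PBang x) P C\<^sub>1) P\<^sub>1 F\<^sub>1"
| d_let_tens: "decomp S\<^sub>1 C\<^sub>1 P\<^sub>1 F\<^sub>1 \<Longrightarrow> tens_pat p \<Longrightarrow>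
    decomp (LET p \<leftarrow> Var z IN S\<^sub>1) (LetC p (Var z) C\<^sub>1) P\<^sub>1 F\<^sub>1"
| d_let_f: "decomp S\<^sub>1 C\<^sub>1 P\<^sub>1 F\<^sub>1 \<Longrightarrow> bound C\<^sub>1 \<inter> FV F = {} \<Longrightarrow>
    decomp (LET sec_pat (PVar f) \<leftarrow> sec_tm F IN S\<^sub>1) C\<^sub>1 P\<^sub>1 (LET sec_pat (PVar f) \<leftarrow> sec_tm F IN F\<^sub>1)"
| d_alpha: "alpha S S' \<Longrightarrow> decomp S' C P F \<Longrightarrow> decomp S C P F"

text \<open>\<open>unzips S T\<close>: the term \<open>T\<close> is a representative of $\mathcal U(S)$ up to renaming of bound
  variables.\<close>

definition unzips :: "'f tm \<Rightarrow> 'f tm \<Rightarrow> bool" where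
  "unzips S T \<longleftrightarrow> (\<exists>C P F. decomp S C P F \<and> alpha (plug C (Tens P (sec_tm F))) T)"

end

(* Unzipping only permutes the bindings of S, and the free variables of the result are those of S. A
   bound variable is charged to the workload only if it does not occur in its scope; moving the
   terms F inwards under the binders of a context enlarges these scopes, and since the variables
   bound in contexts have types E whereas the f have types L \<multimap> H, no scope loses a variable that it
   binds. No new !M' is created, and the only new pairs have the form \<section>F. *)

theory Submission
  imports Defs
begin

section \<open>Renaming and alpha-equivalence\<close>

definition ty_perm :: "(var \<Rightarrow> var) \<Rightarrow> bool" where
  "ty_perm \<pi> \<longleftrightarrow> bij \<pi> \<and> (\<forall>x. vty (\<pi> x) = vty x)"

lemma ty_perm_id: "ty_perm (\<lambda>x. x)"
  by (simp add: ty_perm_def bij_id[unfolded id_def])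

lemma ty_perm_comp: "ty_perm \<pi> \<Longrightarrow> ty_perm \<rho> \<Longrightarrow> ty_perm (\<lambda>x. \<pi> (\<rho> x))"
  using bij_comp[of \<rho> \<pi>] by (simp add: ty_perm_def comp_def)

lemma ty_perm_inj: "ty_perm \<pi> \<Longrightarrow> inj \<pi>"
  by (simp add: ty_perm_def bij_is_inj)

lemma ty_perm_vty [simp]: "ty_perm \<pi> \<Longrightarrow> vty (\<pi> x) = vty x"
  by (simp add: ty_perm_def)

section \<open>Free variables and workload under renaming\<close>

lemma finite_pvars [simp]: "finite (pvars p)"
  by (induction p) auto

lemma finite_FV [simp]: "finite (FV M)"
  by (induction M) auto

lemma pvars_rename_pat [simp]: "pvars (rename_pat \<pi> p) = \<pi> ` pvars p"
  by (induction p) auto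

lemma FV_rename [simp]: "ty_perm \<pi> \<Longrightarrow> FV (rename \<pi> M) = \<pi> ` FV M"
  by (induction M) (auto simp: image_Un image_set_diff ty_perm_inj)

lemma rename_pat_id [simp]: "rename_pat (\<lambda>x. x) p = p"
  by (induction p) simp_all

lemma rename_id [simp]: "rename (\<lambda>x. x) M = M"
  by (induction M) simp_all

lemma rename_pat_comp [simp]: "rename_pat \<pi> (rename_pat \<rho> p) = rename_pat (\<lambda>x. \<pi> (\<rho> x)) p"
  by (induction p) simp_all

lemma rename_comp [simp]: "rename \<pi> (rename \<rho> M) = rename (\<lambda>x. \<pi> (\<rho> x)) M"
  by (induction M) simp_all

text \<open>An injective map commutes with set difference, and types are preserved; the sum is the
  charge of a binder.\<close>

lemma sum_unused_rename:
  assumes "ty_perm \<pi>"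
  shows "(\<Sum>x \<in> \<pi> ` A - \<pi> ` B. workload_ty (vty x)) = (\<Sum>x \<in> A - B. workload_ty (vty x))"
proof -
  have "\<pi> ` A - \<pi> ` B = \<pi> ` (A - B)"
    using assms by (simp add: image_set_diff ty_perm_inj)
  then show ?thesis
    using assms by (simp add: sum.reindex inj_on_subset[OF ty_perm_inj])
qed

lemma workload_rename [simp]: "ty_perm \<pi> \<Longrightarrow> workload (rename \<pi> M) = workload M"
  by (induction M) (simp_all add: sum_unused_rename)

section \<open>Invariants of alpha-equivalence and fresh names\<close>

lemma alpha_refl: "alpha M M"
proof (induction M)
  case (Lam p M)
  then show ?case
    using alpha.intros(3)[of "\<lambda>x. x" p M M] ty_perm_id by (simp add: ty_perm_def)
qed (auto intro: alpha.intros)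

lemma alpha_FV: "alpha M M' \<Longrightarrow> FV M' = FV M"
proof (induction rule: alpha.induct)
  case (3 \<pi> p M M')
  then have \<pi>: "ty_perm \<pi>"
    by (simp add: ty_perm_def)
  have "FV (Lam (rename_pat \<pi> p) M') = \<pi> ` FV (Lam p M)"
    using \<pi> 3(5) by (simp add: image_set_diff ty_perm_inj)
  \<comment> \<open>The binder rule makes \<open>\<pi>\<close> fix the free variables of the
    abstraction pointwise.\<close>
  also have "\<dots> = FV (Lam p M)"
    using 3(3) by force
  finally show ?case .
qed auto

lemma alpha_workload: "alpha M M' \<Longrightarrow> workload M' = workload M"
proof (induction rule: alpha.induct)
  case (3 \<pi> p M M')
  then have \<pi>: "ty_perm \<pi>"
    by (simp add: ty_perm_def)
  then show ?case
    using 3 alpha_FV[OF 3(4)] by (simp add: sum_unused_rename)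
qed auto

text \<open>Each type has infinitely many names, so \<open>Y\<close> can be exchanged with a copy of
  itself whose names exceed all those in use; all other variables stay.\<close>

lemma ex_fresh_ty_perm:
  assumes "finite X" "finite Y" "finite Z" "Y \<inter> Z = {}"
  obtains \<pi> where "ty_perm \<pi>" "\<forall>x\<in>Z. \<pi> x = x" "\<pi> ` Y \<inter> X = {}"
proof -
  have "finite (vname ` (X \<union> Y \<union> Z))"
    using assms by simp
  then obtain n where n: "\<forall>x \<in> X \<union> Y \<union> Z. vname x < n"
    using finite_nat_set_iff_bounded by auto
  define up where "up x = V (vname x + n) (vty x)" for x
  define down where "down x = V (vname x - n) (vty x)" for x
  define \<pi> where "\<pi> x = (if x \<in> Y then up x else if x \<in> up ` Y then down x else x)" for x
  have down_up: "down (up x) = x" for x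
    by (simp add: up_def down_def)
  have up_fresh: "up x \<notin> X \<union> Y \<union> Z" for x
    using n by (force simp: up_def)
  \<comment> \<open>As \<open>up\<close> maps \<open>Y\<close> outside \<open>Y\<close>,
    \<open>\<pi>\<close> swaps each \<open>x\<close> in \<open>Y\<close> with \<open>up x\<close>;
    an involution is bijective.\<close>
  have "\<pi> (\<pi> x) = x" for x
    using up_fresh by (auto simp: \<pi>_def down_up)
  then have "bij \<pi>"
    by (metis involuntory_imp_bij)
  moreover have "vty (\<pi> x) = vty x" for x
    by (simp add: \<pi>_def up_def down_def)
  ultimately have "ty_perm \<pi>"
    by (simp add: ty_perm_def)
  moreover have "\<forall>x\<in>Z. \<pi> x = x"
    using assms(4) up_fresh by (auto simp: \<pi>_def)
  moreover have "\<pi> ` Y \<inter> X = {}"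
    using up_fresh by (auto simp: \<pi>_def)
  ultimately show thesis
    using that by blast
qed

text \<open>The variables of the pattern can move while the free variables of the abstraction stay
  fixed, because the two sets are disjoint.\<close>

lemma ex_alpha_Lam:
  assumes "finite X"
  obtains \<pi> where "ty_perm \<pi>" "\<pi> ` pvars p \<inter> X = {}"
    "alpha (Lam p M) (Lam (rename_pat \<pi> p) (rename \<pi> M))"
proof -
  obtain \<pi> where \<pi>: "ty_perm \<pi>" "\<forall>x \<in> FV (Lam p M). \<pi> x = x" "\<pi> ` pvars p \<inter> X = {}"
    using ex_fresh_ty_perm[of X "pvars p" "FV (Lam p M)"] assms by auto
  have "alpha (Lam p M) (Lam (rename_pat \<pi> p) (rename \<pi> M))"
    using \<pi> by (intro alpha.intros(3) alpha_refl) (auto simp: ty_perm_def)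
  with \<pi> show thesis
    by (intro that)
qed


section \<open>Safety\<close>

text \<open>Recursive equations in place of the quantification over subterms, so that inductions
  handle safety by simplification.\<close>

lemma safe_simps [simp]:
  "safe (Var x)" "safe Unit" "safe Top" "safe (Const r)" "safe (Fun g)" "safe Plus" "safe Times"
  "safe (Bang M) \<longleftrightarrow> workload M = 0 \<and> safe M"
  "safe (Lam p M) \<longleftrightarrow> safe M"
  "safe (App M N) \<longleftrightarrow> safe M \<and> safe N"
  "safe (Tens M N) \<longleftrightarrow> safe M \<and> safe N"
  "safe (Pair M N) \<longleftrightarrow> (\<forall>x \<in> FV M \<inter> FV N. ground_ty (vty x)) \<and> safe M \<and> safe N"
  unfolding safe_def by auto

lemma safe_rename [simp]: "ty_perm \<pi> \<Longrightarrow> safe (rename \<pi> M) = safe M"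
proof (induction M)
  case (Pair M N)
  then show ?case
    by (simp add: image_Int[OF ty_perm_inj, symmetric])
qed simp_all

lemma alpha_safe: "alpha M M' \<Longrightarrow> safe M' = safe M"
proof (induction rule: alpha.induct)
  case (3 \<pi> p M M')
  then have "ty_perm \<pi>"
    by (simp add: ty_perm_def)
  then show ?case
    using 3 by simp
qed (simp_all add: alpha_FV alpha_workload)


section \<open>Contexts\<close>

text \<open>The contribution of the \<open>let\<close>-bound terms; together with
  \<open>bound\<close> it determines the free variables of any plugged term, see
  \<open>FV_plug\<close>.\<close>

primrec FVC :: "'f ctx \<Rightarrow> var set" where
  "FVC Hole = {}"
| "FVC (LetC p N C) = FV N \<union> (FVC C - pvars p)"

primrec safeC :: "'f ctx \<Rightarrow> bool" where
  "safeC Hole = True"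
| "safeC (LetC p N C) = (safe N \<and> safeC C)"

lemma plug_ctx_comp [simp]: "plug (ctx_comp C D) M = plug C (plug D M)"
  by (induction C) auto

lemma bound_ctx_comp [simp]: "bound (ctx_comp C D) = bound C \<union> bound D"
  by (induction C) auto

lemma FVC_ctx_comp: "FVC (ctx_comp C D) = FVC C \<union> (FVC D - bound C)"
  by (induction C) auto

lemma FV_plug: "FV (plug C M) = FVC C \<union> (FV M - bound C)"
  by (induction C) auto

lemma safe_plug: "safe (plug C M) \<longleftrightarrow> safeC C \<and> safe M"
  by (induction C) auto

text \<open>Evaluates the charge of a pattern one variable at a time.\<close>

lemma sum_insert_Diff:
  "finite A \<Longrightarrow> a \<notin> A \<Longrightarrow>
    sum g (insert a A - B) = (if a \<in> B then 0 else g a :: nat) + sum g (A - B)"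
  by (simp add: insert_Diff_if)

text \<open>Replacing \<open>M\<close> by \<open>M'\<close> in the hole changes the workload by that
  of the two terms and by the charges of the binders of \<open>C\<close>; these can only drop if
  \<open>M'\<close> keeps every variable of \<open>M\<close> that \<open>C\<close> binds. The
  additive form avoids truncated subtraction.\<close>

lemma workload_plug_mono:
  assumes "FV M \<inter> bound C \<subseteq> FV M'"
  shows "workload (plug C M') + workload M \<le> workload (plug C M) + workload M'"
  using assms
proof (induction C)
  case (LetC p N C)
  have "pvars p - FV (plug C M') \<subseteq> pvars p - FV (plug C M)"
    using LetC.prems by (auto simp: FV_plug)
  then have "(\<Sum>x \<in> pvars p - FV (plug C M'). workload_ty (vty x))
      \<le> (\<Sum>x \<in> pvars p - FV (plug C M). workload_ty (vty x))"
    by (intro sum_mono2) auto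
  moreover have "workload (plug C M') + workload M \<le> workload (plug C M) + workload M'"
    using LetC by auto
  ultimately show ?case
    by simp
qed simp


section \<open>Unzippable terms\<close>

text \<open>An over-approximation of \<open>frag_A\<close> that, not mentioning typing derivations, is visibly closed
  under renaming of bound variables.\<close>

inductive unzippable :: "'f tm \<Rightarrow> bool" where
  u_pair: "\<forall>x \<in> FV P. E_var x \<Longrightarrow> unzippable (Tens P (sec_tm F))"
| u_let_A: "E_var x \<Longrightarrow> LH_var f \<Longrightarrow> unzippable S \<Longrightarrow> unzippable R \<Longrightarrow>
    unzippable (LET PTens (PBang x) (sec_pat (PVar f)) \<leftarrow> S IN R)"
| u_let_f: "LH_var f \<Longrightarrow> unzippable R \<Longrightarrow> unzippable (LET sec_pat (PVar f) \<leftarrow> sec_tm F IN R)"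
| u_let_p: "E_var x \<Longrightarrow> \<forall>y \<in> FV P. E_var y \<Longrightarrow> unzippable R \<Longrightarrow>
    unzippable (LET PBang x \<leftarrow> P IN R)"
| u_let_tens: "tens_pat p \<Longrightarrow> E_var z \<Longrightarrow> unzippable R \<Longrightarrow> unzippable (LET p \<leftarrow> Var z IN R)"

inductive_cases unzippable_TensE: "unzippable (Tens P (sec_tm F))"
inductive_cases unzippable_AppE: "unzippable (App M N)"
inductive_cases alpha_AppE: "alpha (App M N) T"
inductive_cases alpha_LamE: "alpha (Lam p M) T"
inductive_cases alpha_TensE: "alpha (Tens M N) T"
inductive_cases alpha_PairE: "alpha (Pair M N) T"
inductive_cases alpha_UnitE: "alpha Unit T"
inductive_cases alpha_VarE: "alpha (Var x) T"

lemma E_var_perm [simp]: "ty_perm \<pi> \<Longrightarrow> E_var (\<pi> x) = E_var x"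
  by (simp add: E_var_def)

lemma LH_var_perm [simp]: "ty_perm \<pi> \<Longrightarrow> LH_var (\<pi> x) = LH_var x"
  by (simp add: LH_var_def)

text \<open>No type of the form \<open>E\<close> is an arrow. This is what keeps function variables
  out of contexts.\<close>

lemma LH_var_not_E_var: "LH_var f \<Longrightarrow> \<not> E_var f"
  by (auto simp: LH_var_def E_var_def elim: E_ty.cases)

lemma tens_pat_E_var: "tens_pat p \<Longrightarrow> \<forall>x \<in> pvars p. E_var x"
  by (induction rule: tens_pat.induct) auto

lemma tens_pat_rename: "tens_pat p \<Longrightarrow> ty_perm \<pi> \<Longrightarrow> tens_pat (rename_pat \<pi> p)"
  by (induction rule: tens_pat.induct) (auto intro!: tens_pat.intros dest: ty_perm_inj injD)

lemma alpha_rename_LetInE: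
  assumes "ty_perm \<pi>" "alpha (rename \<pi> (LET p \<leftarrow> N IN M)) T"
  obtains \<rho> M' N' where "ty_perm \<rho>" "T = (LET rename_pat \<rho> p \<leftarrow> N' IN M')"
    "alpha (rename \<rho> M) M'" "alpha (rename \<pi> N) N'"
proof -
  \<comment> \<open>The body undergoes \<open>\<pi>\<close> and then the permutation
    \<open>\<sigma>\<close> of the binder rule; the bound term lies outside the scope and sees only
    \<open>\<pi>\<close>.\<close>
  obtain \<sigma> M' N' where "ty_perm \<sigma>" "T = (LET rename_pat \<sigma> (rename_pat \<pi> p) \<leftarrow> N' IN M')"
    "alpha (rename \<sigma> (rename \<pi> M)) M'" "alpha (rename \<pi> N) N'"
    using assms(2) by (auto elim!: alpha_AppE alpha_LamE simp: ty_perm_def)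
  then show thesis
    using that[OF ty_perm_comp[OF _ assms(1)]] by simp
qed

text \<open>The binder rule of \<open>alpha\<close> renames the body before comparing it, so the
  induction has to allow an arbitrary renaming first.\<close>

lemma unzippable_alpha_rename:
  assumes "unzippable S" "ty_perm \<pi>" "alpha (rename \<pi> S) T"
  shows "unzippable T"
  using assms
proof (induction arbitrary: \<pi> T rule: unzippable.induct)
  case (u_pair P F)
  then obtain P' F' where "T = Tens P' (sec_tm F')" "alpha (rename \<pi> P) P'"
    by (auto elim!: alpha_TensE alpha_PairE alpha_UnitE)
  then show ?case
    using u_pair by (auto intro!: unzippable.intros simp: alpha_FV)
next
  case (u_let_A x f S R)
  obtain \<rho> M N where \<rho>: "ty_perm \<rho>" "T = (LET rename_pat \<rho> (PTens (PBang x) (sec_pat (PVar f))) \<leftarrow> N IN M)"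
    "alpha (rename \<rho> R) M" "alpha (rename \<pi> S) N"
    using alpha_rename_LetInE[OF u_let_A.prems] .
  have "unzippable M"
    using u_let_A.IH(2) \<rho>(1,3) .
  moreover have "unzippable N"
    using u_let_A.IH(1) u_let_A.prems(1) \<rho>(4) .
  ultimately show ?case
    using u_let_A.hyps \<rho>(1,2) by (simp add: unzippable.u_let_A)
next
  case (u_let_f f R F)
  obtain \<rho> M N where \<rho>: "ty_perm \<rho>" "T = (LET rename_pat \<rho> (sec_pat (PVar f)) \<leftarrow> N IN M)"
    "alpha (rename \<rho> R) M" "alpha (rename \<pi> (sec_tm F)) N"
    using alpha_rename_LetInE[OF u_let_f.prems] .
  have "unzippable M"
    using u_let_f.IH \<rho>(1,3) .
  moreover obtain F' where "N = sec_tm F'"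
    using \<rho>(4) by (auto elim!: alpha_PairE alpha_UnitE)
  ultimately show ?case
    using u_let_f.hyps \<rho>(1,2) by (simp add: unzippable.u_let_f)
next
  case (u_let_p x P R)
  obtain \<rho> M N where \<rho>: "ty_perm \<rho>" "T = (LET rename_pat \<rho> (PBang x) \<leftarrow> N IN M)"
    "alpha (rename \<rho> R) M" "alpha (rename \<pi> P) N"
    using alpha_rename_LetInE[OF u_let_p.prems] .
  have "unzippable M"
    using u_let_p.IH \<rho>(1,3) .
  moreover have "\<forall>y \<in> FV N. E_var y"
    using u_let_p.hyps u_let_p.prems(1) alpha_FV[OF \<rho>(4)] by auto
  ultimately show ?case
    using u_let_p.hyps \<rho>(1,2) by (simp add: unzippable.u_let_p)
next
  case (u_let_tens p z R)
  obtain \<rho> M N where \<rho>: "ty_perm \<rho>" "T = (LET rename_pat \<rho> p \<leftarrow> N IN M)"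
    "alpha (rename \<rho> R) M" "alpha (rename \<pi> (Var z)) N"
    using alpha_rename_LetInE[OF u_let_tens.prems] .
  have "unzippable M"
    using u_let_tens.IH \<rho>(1,3) .
  moreover have "N = Var (\<pi> z)"
    using \<rho>(4) by (auto elim: alpha_VarE)
  ultimately show ?case
    using u_let_tens.hyps u_let_tens.prems(1) \<rho>(1,2)
    by (simp add: unzippable.u_let_tens tens_pat_rename)
qed

text \<open>Carries the invariant across rule \<open>d_alpha\<close>.\<close>

lemma unzippable_alpha: "unzippable S \<Longrightarrow> alpha S T \<Longrightarrow> unzippable T"
  using unzippable_alpha_rename[OF _ ty_perm_id] by simp

lemma FV_tens_tm: "FV (tens_tm Ms) = (\<Union>M \<in> set Ms. FV M)"
  by (induction Ms rule: tens_tm.induct) auto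

lemma frag_p_FV: "frag_p ar P \<Longrightarrow> \<forall>x \<in> FV P. E_var x"
  by (induction rule: frag_p.induct) (auto simp: FV_tens_tm)

lemma frag_A_unzippable: "frag_A ar S \<Longrightarrow> unzippable S"
  by (induction rule: frag_A.induct) (auto intro!: unzippable.intros simp: frag_p_FV)


section \<open>Unzipping\<close>

text \<open>The premises of \<open>d_let_A\<close> are met by choosing \<open>C\<^sub>1\<close> first, away from \<open>S\<^sub>2\<close>, and only then the new name
  of \<open>x\<close> and the context \<open>C\<^sub>2\<close>, away from \<open>F\<^sub>1\<close>.\<close>

lemma ex_decomp_rename:
  assumes "unzippable S" "ty_perm \<pi>" "finite X"
  shows "\<exists>C P F. decomp (rename \<pi> S) C P F \<and> bound C \<inter> X = {}"
  using assms
proof (induction arbitrary: \<pi> X rule: unzippable.induct)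
  case (u_pair P F)
  then show ?case
    using d_pair by fastforce
next
  case (u_let_A x f S R)
  let ?p = "PTens (PBang (\<pi> x)) (sec_pat (PVar (\<pi> f)))"
  \<comment> \<open>Avoiding the free variables of the abstraction rather than of its body makes
    this choice survive the later renaming of the binder.\<close>
  obtain C\<^sub>1 P\<^sub>1 F\<^sub>1 where 1: "decomp (rename \<pi> S) C\<^sub>1 P\<^sub>1 F\<^sub>1"
    "bound C\<^sub>1 \<inter> (X \<union> FV (Lam ?p (rename \<pi> R))) = {}"
    using u_let_A.IH(1)[of \<pi> "X \<union> FV (Lam ?p (rename \<pi> R))"] u_let_A.prems by auto
  \<comment> \<open>In the result the binder of \<open>x\<close> encloses \<open>F\<^sub>1\<close>,
    so it is renamed away from \<open>FV F\<^sub>1\<close> and \<open>X\<close>.\<close>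
  obtain \<rho> where \<rho>: "ty_perm \<rho>" "\<rho> ` pvars ?p \<inter> (X \<union> FV F\<^sub>1) = {}"
    "alpha (Lam ?p (rename \<pi> R))
       (Lam (rename_pat \<rho> ?p) (rename \<rho> (rename \<pi> R)))"
    using ex_alpha_Lam[of "X \<union> FV F\<^sub>1"] u_let_A.prems by (metis finite_FV finite_UnI)
  obtain C\<^sub>2 P\<^sub>2 F\<^sub>2 where 2: "decomp (rename (\<lambda>x. \<rho> (\<pi> x)) R) C\<^sub>2 P\<^sub>2 F\<^sub>2" "bound C\<^sub>2 \<inter> (X \<union> FV F\<^sub>1) = {}"
    using u_let_A.IH(2)[of "\<lambda>x. \<rho> (\<pi> x)" "X \<union> FV F\<^sub>1"] u_let_A.prems \<rho>(1) by (auto simp: ty_perm_comp)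
  have "FV (Lam (rename_pat \<rho> ?p) (rename \<rho> (rename \<pi> R))) = FV (Lam ?p (rename \<pi> R))"
    using \<rho>(3) by (rule alpha_FV)
  then have C\<^sub>1: "bound C\<^sub>1 \<inter> (FV (rename (\<lambda>x. \<rho> (\<pi> x)) R) - {\<rho> (\<pi> x), \<rho> (\<pi> f)}) = {}"
    using 1(2) \<rho>(1) u_let_A.prems(1) by auto
  have "insert (\<rho> (\<pi> x)) (bound C\<^sub>2) \<inter> FV F\<^sub>1 = {}"
    using \<rho>(2) 2(2) by auto
  from d_let_A[OF 1(1) 2(1) C\<^sub>1 this]
  have "decomp (LET rename_pat \<rho> ?p \<leftarrow> rename \<pi> S IN rename \<rho> (rename \<pi> R))
      (ctx_comp C\<^sub>1 (LetC (PBang (\<rho> (\<pi> x))) P\<^sub>1 C\<^sub>2)) P\<^sub>2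
      (LET sec_pat (PVar (\<rho> (\<pi> f))) \<leftarrow> sec_tm F\<^sub>1 IN F\<^sub>2)"
    by simp
  from d_alpha[OF alpha.intros(4)[OF \<rho>(3) alpha_refl] this]
  have "decomp (rename \<pi> (LET PTens (PBang x) (sec_pat (PVar f)) \<leftarrow> S IN R))
      (ctx_comp C\<^sub>1 (LetC (PBang (\<rho> (\<pi> x))) P\<^sub>1 C\<^sub>2)) P\<^sub>2
      (LET sec_pat (PVar (\<rho> (\<pi> f))) \<leftarrow> sec_tm F\<^sub>1 IN F\<^sub>2)"
    by simp
  moreover have "bound (ctx_comp C\<^sub>1 (LetC (PBang (\<rho> (\<pi> x))) P\<^sub>1 C\<^sub>2)) \<inter> X = {}"
    using 1(2) 2(2) \<rho>(2) by auto
  ultimately show ?case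
    by blast
next
  case (u_let_f f R F)
  \<comment> \<open>\<open>F\<close> moves under the binders of \<open>C\<close>; enlarging the
    avoided set excludes capture.\<close>
  obtain C P F' where "decomp (rename \<pi> R) C P F'" "bound C \<inter> (X \<union> FV (rename \<pi> F)) = {}"
    using u_let_f.IH[of \<pi> "X \<union> FV (rename \<pi> F)"] u_let_f.prems by auto
  then have "decomp (rename \<pi> (LET sec_pat (PVar f) \<leftarrow> sec_tm F IN R)) C P
      (LET sec_pat (PVar (\<pi> f)) \<leftarrow> sec_tm (rename \<pi> F) IN F')" "bound C \<inter> X = {}"
    by (auto intro!: d_let_f)
  then show ?case
    by blast
next
  case (u_let_p x P R)
  \<comment> \<open>\<open>x\<close> becomes a variable bound by the context, so it has to leave
    \<open>X\<close> as well.\<close>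
  obtain \<rho> where \<rho>: "ty_perm \<rho>" "\<rho> ` pvars (PBang (\<pi> x)) \<inter> X = {}"
    "alpha (Lam (PBang (\<pi> x)) (rename \<pi> R))
       (Lam (rename_pat \<rho> (PBang (\<pi> x))) (rename \<rho> (rename \<pi> R)))"
    using ex_alpha_Lam[OF u_let_p.prems(2)] by metis
  obtain C Q F where 2: "decomp (rename (\<lambda>x. \<rho> (\<pi> x)) R) C Q F" "bound C \<inter> X = {}"
    using u_let_p.IH[of "\<lambda>x. \<rho> (\<pi> x)" X] u_let_p.prems \<rho>(1) by (auto simp: ty_perm_comp)
  have "decomp (rename \<pi> (LET PBang x \<leftarrow> P IN R)) (LetC (PBang (\<rho> (\<pi> x))) (rename \<pi> P) C) Q F"
    using d_alpha[OF alpha.intros(4)[OF \<rho>(3) alpha_refl]] d_let_p[OF 2(1)] by simp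
  moreover have "bound (LetC (PBang (\<rho> (\<pi> x))) (rename \<pi> P) C) \<inter> X = {}"
    using 2 \<rho> by auto
  ultimately show ?case
    by blast
next
  case (u_let_tens p z R)
  obtain \<rho> where \<rho>: "ty_perm \<rho>" "\<rho> ` pvars (rename_pat \<pi> p) \<inter> X = {}"
    "alpha (Lam (rename_pat \<pi> p) (rename \<pi> R))
       (Lam (rename_pat \<rho> (rename_pat \<pi> p)) (rename \<rho> (rename \<pi> R)))"
    using ex_alpha_Lam[OF u_let_tens.prems(2)] by metis
  obtain C Q F where 2: "decomp (rename (\<lambda>x. \<rho> (\<pi> x)) R) C Q F" "bound C \<inter> X = {}"
    using u_let_tens.IH[of "\<lambda>x. \<rho> (\<pi> x)" X] u_let_tens.prems \<rho>(1) by (auto simp: ty_perm_comp)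
  have "tens_pat (rename_pat (\<lambda>x. \<rho> (\<pi> x)) p)"
    by (rule tens_pat_rename[OF u_let_tens.hyps(1) ty_perm_comp[OF \<rho>(1) u_let_tens.prems(1)]])
  then have "decomp (rename \<pi> (LET p \<leftarrow> Var z IN R))
      (LetC (rename_pat (\<lambda>x. \<rho> (\<pi> x)) p) (Var (\<pi> z)) C) Q F"
    using d_alpha[OF alpha.intros(4)[OF \<rho>(3) alpha_refl]] d_let_tens[OF 2(1)] by simp
  moreover have "bound (LetC (rename_pat (\<lambda>x. \<rho> (\<pi> x)) p) (Var (\<pi> z)) C) \<inter> X = {}"
    using 2 \<rho> by auto
  ultimately show ?case
    by blast
qed

lemma ex_unzips:
  assumes "unzippable S"
  shows "\<exists>T. unzips S T"
proof -
  obtain C P F where "decomp S C P F"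
    using ex_decomp_rename[OF assms ty_perm_id, of "{}"] by auto
  then show ?thesis
    using alpha_refl unfolding unzips_def by blast
qed

section \<open>Safety, free variables and workload of a decomposition\<close>

lemma decomp_safe: "decomp S C P F \<Longrightarrow> safe S \<longleftrightarrow> safe (plug C (Tens P (sec_tm F)))"
  \<comment> \<open>The first component of each pair \<open>\<section>F\<close> is
    \<open>Unit\<close>, so its components share no variable, and safety reduces to that of the
    pieces, which are the same on both sides.\<close>
  by (induction rule: decomp.induct) (auto simp: safe_plug alpha_safe)

text \<open>Used to see that a function variable can occur only in the third component.
  \<open>FV P\<close> belongs to the claim because \<open>P\<^sub>1\<close> becomes a bound term of
  the context in rule \<open>d_let_A\<close>.\<close>

lemma decomp_E_vars:
  assumes "decomp S C P F" "unzippable S"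
  shows "\<forall>x \<in> bound C \<union> FVC C \<union> FV P. E_var x"
  using assms
proof (induction rule: decomp.induct)
  case (d_alpha S S' C P F)
  then show ?case
    using unzippable_alpha by blast
qed (auto elim!: unzippable_TensE unzippable_AppE elim: tens_pat.cases
    simp: FVC_ctx_comp dest: tens_pat_E_var)

text \<open>The premises of \<open>decomp\<close> exclude captures, and the binder of
  \<open>f\<close>, though moved inwards, still covers what it bound before.\<close>

lemma decomp_FV:
  assumes "decomp S C P F" "unzippable S"
  shows "FV (plug C (Tens P (sec_tm F))) = FV S"
  using assms
proof (induction rule: decomp.induct)
  case (d_let_A S\<^sub>1 C\<^sub>1 P\<^sub>1 F\<^sub>1 S\<^sub>2 C\<^sub>2 P\<^sub>2 F\<^sub>2 x f)
  then have u: "unzippable S\<^sub>1" "unzippable S\<^sub>2" "E_var x" "LH_var f"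
    by (auto elim: unzippable_AppE tens_pat.cases)
  have S: "FV S\<^sub>1 = FVC C\<^sub>1 \<union> ((FV P\<^sub>1 \<union> FV F\<^sub>1) - bound C\<^sub>1)"
    "FV S\<^sub>2 = FVC C\<^sub>2 \<union> ((FV P\<^sub>2 \<union> FV F\<^sub>2) - bound C\<^sub>2)"
    using d_let_A.IH u by (simp_all add: FV_plug)
  \<comment> \<open>By the types of the variables, a free \<open>f\<close> of
    \<open>S\<^sub>2\<close> can only come from \<open>F\<^sub>2\<close>.\<close>
  have f: "f \<notin> bound C\<^sub>1 \<union> bound C\<^sub>2 \<union> FVC C\<^sub>1 \<union> FVC C\<^sub>2 \<union> FV P\<^sub>2"
    using decomp_E_vars[OF d_let_A.hyps(1) u(1)] decomp_E_vars[OF d_let_A.hyps(2) u(2)]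
      LH_var_not_E_var[OF u(4)] by blast
  \<comment> \<open>\<open>F\<^sub>1\<close> is captured neither by \<open>x\<close> nor by
    \<open>C\<^sub>2\<close>, and it lies outside the scope of \<open>f\<close>.\<close>
  have "FV (plug C\<^sub>2 (Tens P\<^sub>2 (sec_tm (LET sec_pat (PVar f) \<leftarrow> sec_tm F\<^sub>1 IN F\<^sub>2)))) - {x}
      = FV F\<^sub>1 \<union> (FV S\<^sub>2 - {x, f})"
    using d_let_A.hyps(4) f by (auto simp: S FV_plug)
  then have "FV (plug (ctx_comp C\<^sub>1 (LetC (PBang x) P\<^sub>1 C\<^sub>2))
        (Tens P\<^sub>2 (sec_tm (LET sec_pat (PVar f) \<leftarrow> sec_tm F\<^sub>1 IN F\<^sub>2))))
      = FVC C\<^sub>1 \<union> ((FV P\<^sub>1 \<union> FV F\<^sub>1 \<union> (FV S\<^sub>2 - {x, f})) - bound C\<^sub>1)"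
    by (simp add: FV_plug[of C\<^sub>1]) blast
  also have "\<dots> = FV S\<^sub>1 \<union> (FV S\<^sub>2 - {x, f})"
    using d_let_A.hyps(3) by (auto simp: S(1))
  finally show ?case
    by auto
next
  case (d_let_f S\<^sub>1 C\<^sub>1 P\<^sub>1 F\<^sub>1 F f)
  then have u: "unzippable S\<^sub>1" "LH_var f"
    by (auto elim: unzippable_AppE tens_pat.cases)
  then have "f \<notin> bound C\<^sub>1 \<union> FVC C\<^sub>1 \<union> FV P\<^sub>1"
    using decomp_E_vars[OF d_let_f.hyps(1)] LH_var_not_E_var by blast
  then show ?case
    using d_let_f.hyps(2) d_let_f.IH[OF u(1), symmetric] by (auto simp: FV_plug)
next
  case (d_alpha S S' C P F)
  then show ?case
    using unzippable_alpha alpha_FV by blast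
qed (auto elim: unzippable_AppE tens_pat.cases)

text \<open>Both terms are built from the same pieces, so only charges of binders can differ; they
  are compared through inclusions of free variables.\<close>

lemma decomp_workload:
  assumes "decomp S C P F" "unzippable S"
  shows "workload (plug C (Tens P (sec_tm F))) \<le> workload S"
  using assms
proof (induction rule: decomp.induct)
  case (d_let_A S\<^sub>1 C\<^sub>1 P\<^sub>1 F\<^sub>1 S\<^sub>2 C\<^sub>2 P\<^sub>2 F\<^sub>2 x f)
  then have u: "unzippable S\<^sub>1" "unzippable S\<^sub>2" "E_var x" "LH_var f"
    by (auto elim: unzippable_AppE tens_pat.cases)
  have f: "f \<notin> bound C\<^sub>1 \<union> bound C\<^sub>2 \<union> FVC C\<^sub>2 \<union> FV P\<^sub>2" "x \<noteq> f"
    using decomp_E_vars[OF d_let_A.hyps(1) u(1)] decomp_E_vars[OF d_let_A.hyps(2) u(2)]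
      LH_var_not_E_var[OF u(4)] u(3) by blast+
  have S\<^sub>2: "FV S\<^sub>2 = FVC C\<^sub>2 \<union> ((FV P\<^sub>2 \<union> FV F\<^sub>2) - bound C\<^sub>2)"
    using decomp_FV[OF d_let_A.hyps(2) u(2)] by (simp add: FV_plug)
  let ?F = "LET sec_pat (PVar f) \<leftarrow> sec_tm F\<^sub>1 IN F\<^sub>2"
  let ?T = "plug C\<^sub>2 (Tens P\<^sub>2 (sec_tm ?F))"
  let ?B = "LET PBang x \<leftarrow> P\<^sub>1 IN ?T"
  \<comment> \<open>\<open>?B\<close> contains \<open>P\<^sub>1\<close> and leaves
    \<open>F\<^sub>1\<close> uncaptured, so no variable bound by \<open>C\<^sub>1\<close> drops out
    of its scope.\<close>
  have "workload (plug C\<^sub>1 ?B) + workload (Tens P\<^sub>1 (sec_tm F\<^sub>1))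
      \<le> workload (plug C\<^sub>1 (Tens P\<^sub>1 (sec_tm F\<^sub>1))) + workload ?B"
    using d_let_A.hyps(4) by (intro workload_plug_mono) (auto simp: FV_plug)
  \<comment> \<open>Wrapping \<open>F\<^sub>2\<close> in the \<open>let\<close> removes at most
    \<open>f\<close>, which \<open>C\<^sub>2\<close> does not bind.\<close>
  moreover have "workload ?T + workload (Tens P\<^sub>2 (sec_tm F\<^sub>2))
      \<le> workload (plug C\<^sub>2 (Tens P\<^sub>2 (sec_tm F\<^sub>2))) + workload (Tens P\<^sub>2 (sec_tm ?F))"
    using f by (intro workload_plug_mono) auto
  \<comment> \<open>This and the next fact say that the charges of \<open>x\<close> and
    \<open>f\<close> do not grow.\<close>
  moreover have "x \<in> FV S\<^sub>2 \<Longrightarrow> x \<in> FV ?T"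
    using f(2) by (auto simp: S\<^sub>2 FV_plug)
  moreover have "f \<in> FV S\<^sub>2 \<Longrightarrow> f \<in> FV F\<^sub>2"
    using f(1) by (auto simp: S\<^sub>2)
  ultimately show ?case
    using d_let_A.IH u f(2) by (auto simp: sum_insert_Diff split: if_splits)
next
  case (d_let_f S\<^sub>1 C\<^sub>1 P\<^sub>1 F\<^sub>1 F f)
  then have u: "unzippable S\<^sub>1" "LH_var f"
    by (auto elim: unzippable_AppE tens_pat.cases)
  then have f: "f \<notin> bound C\<^sub>1 \<union> FVC C\<^sub>1 \<union> FV P\<^sub>1"
    using decomp_E_vars[OF d_let_f.hyps(1)] LH_var_not_E_var by blast
  let ?F = "LET sec_pat (PVar f) \<leftarrow> sec_tm F IN F\<^sub>1"
  have "workload (plug C\<^sub>1 (Tens P\<^sub>1 (sec_tm ?F))) + workload (Tens P\<^sub>1 (sec_tm F\<^sub>1))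
      \<le> workload (plug C\<^sub>1 (Tens P\<^sub>1 (sec_tm F\<^sub>1))) + workload (Tens P\<^sub>1 (sec_tm ?F))"
    using f by (intro workload_plug_mono) auto
  moreover have "f \<in> FV S\<^sub>1 \<Longrightarrow> f \<in> FV F\<^sub>1"
    using decomp_FV[OF d_let_f.hyps(1) u(1)] f by (auto simp: FV_plug)
  ultimately show ?case
    using d_let_f.IH u by (auto simp: sum_insert_Diff split: if_splits)
next
  case (d_let_p S\<^sub>1 C\<^sub>1 P\<^sub>1 F\<^sub>1 x P)
  then have "unzippable S\<^sub>1"
    by (auto elim: unzippable_AppE tens_pat.cases)
  then show ?case
    using d_let_p.IH decomp_FV[OF d_let_p.hyps(1)] by simp
next
  case (d_let_tens S\<^sub>1 C\<^sub>1 P\<^sub>1 F\<^sub>1 p z)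
  then have "unzippable S\<^sub>1"
    by (auto elim: unzippable_AppE)
  then show ?case
    using d_let_tens.IH decomp_FV[OF d_let_tens.hyps(1)] by simp
next
  case (d_alpha S S' C P F)
  then show ?case
    using unzippable_alpha alpha_workload by metis
qed simp

theorem theorem6p2:
  fixes ar :: "'f \<Rightarrow> nat" and den :: "'f \<Rightarrow> (nat \<Rightarrow> real) \<Rightarrow> real" and S :: "'f tm"
  assumes "signature ar den" and "frag_A ar S"
  shows "(\<exists>T. unzips S T) \<and>
         (\<forall>T. unzips S T \<longrightarrow> workload T \<le> workload S \<and> (safe S \<longrightarrow> safe T))"
proof -
  have u: "unzippable S"
    using assms(2) by (rule frag_A_unzippable)
  \<comment> \<open>Each \<open>T\<close> is an alpha-variant of a plugged decomposition, so both
    bounds transfer by alpha-invariance.\<close>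
  then show ?thesis
    using ex_unzips decomp_workload decomp_safe
    by (fastforce simp: unzips_def alpha_workload alpha_safe)
qed

end
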